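(* Let $H$ be a normal subgroup of a paratopological group $G$. If the paratopological groups $H$ (with the subspace topology) and $G/H$ (with the quotient topology) are feebly compact, then $G$ is feebly compact.
   Context: A paratopological group is a group $G$ with a topology such that the multiplication $G\times G\to G$ is continuous (inversion need not be continuous). A space $X$ is feebly compact if each locally finite family of open subsets of $X$ is finite. No separation axioms are assumed, and $H$ is not assumed to be closed in $G$. *)

theory Defs
  imports "HOL-Analysis.Analysis" "HOL-Algebra.Coset"
begin

locale paratopological_group = group G for G (structure) +
  fixes T :: "'a topology"
  assumes topspace_eq: "topspace T = carrier G"
    and continuous_mult: "continuous_map (prod_topology T T) T (\<lambda>(x, y). x \<otimes> y)"

text \<open>
  Families are sets of sets. This agrees with families indexed by an arbitrary set whose members
  are nonempty: in a locally finite family a nonempty member is repeated only finitely often.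
\<close>

definition feebly_compact :: "'a topology \<Rightarrow> bool" where
  "feebly_compact X \<longleftrightarrow>
     (\<forall>\<U>. (\<forall>U\<in>\<U>. openin X U) \<and> locally_finite_in X \<U> \<longrightarrow> finite \<U>)"

definition quotient_topology :: "'a topology \<Rightarrow> ('a \<Rightarrow> 'b) \<Rightarrow> 'b topology" where
  "quotient_topology X f =
     topology (\<lambda>U. U \<subseteq> f ` topspace X \<and> openin X {x \<in> topspace X. f x \<in> U})"

lemma openin_quotient_topology:
  "openin (quotient_topology X f) U \<longleftrightarrow>
     U \<subseteq> f ` topspace X \<and> openin X {x \<in> topspace X. f x \<in> U}"
proof -
  have "istopology (\<lambda>U. U \<subseteq> f ` topspace X \<and> openin X {x \<in> topspace X. f x \<in> U})"
    unfolding istopology_def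
  proof (intro conjI allI impI)
    fix S U
    assume S: "S \<subseteq> f ` topspace X \<and> openin X {x \<in> topspace X. f x \<in> S}"
      and U: "U \<subseteq> f ` topspace X \<and> openin X {x \<in> topspace X. f x \<in> U}"
    show "S \<inter> U \<subseteq> f ` topspace X" using S by blast
    have "{x \<in> topspace X. f x \<in> S \<inter> U} =
        {x \<in> topspace X. f x \<in> S} \<inter> {x \<in> topspace X. f x \<in> U}" by blast
    moreover have "openin X \<dots>" using S U by (intro openin_Int) blast+
    ultimately show "openin X {x \<in> topspace X. f x \<in> S \<inter> U}" by (simp only:)
  next
    fix \<K>
    assume K: "\<forall>K\<in>\<K>. K \<subseteq> f ` topspace X \<and> openin X {x \<in> topspace X. f x \<in> K}"
    show "\<Union>\<K> \<subseteq> f ` topspace X" using K by blast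
    have "{x \<in> topspace X. f x \<in> \<Union>\<K>} = (\<Union>K\<in>\<K>. {x \<in> topspace X. f x \<in> K})" by blast
    moreover have "openin X \<dots>" using K by (intro openin_Union) blast
    ultimately show "openin X {x \<in> topspace X. f x \<in> \<Union>\<K>}" by (simp only:)
  qed
  then show ?thesis by (simp add: quotient_topology_def)
qed

lemma topspace_quotient_topology [simp]: "topspace (quotient_topology X f) = f ` topspace X"
proof
  show "topspace (quotient_topology X f) \<subseteq> f ` topspace X"
    using openin_quotient_topology[of X f "topspace (quotient_topology X f)"] by simp
  have "{x \<in> topspace X. f x \<in> f ` topspace X} = topspace X" by blast
  then have "openin (quotient_topology X f) (f ` topspace X)"
    by (simp add: openin_quotient_topology)
  then show "f ` topspace X \<subseteq> topspace (quotient_topology X f)" by (rule openin_subset)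
qed

lemma quotient_map_quotient_topology: "quotient_map X (quotient_topology X f) f"
  by (auto simp: quotient_map_def openin_quotient_topology)

lemma (in paratopological_group) topspace_quotient_group:
  "topspace (quotient_topology T (\<lambda>x. H #> x)) = carrier (G Mod H)"
  by (auto simp: topspace_eq FactGroup_def RCOSETS_def)

end

theory Submission
  imports Defs
begin

text \<open>
  Feeble compactness of a space is equivalent to that of its semiregularization, and the
  semiregularization of a paratopological group is a regular paratopological group. So \<open>G\<close> may be
  assumed regular. Call a paratopological group weakly clustering if for every sequence of nonempty
  open sets \<open>A\<^sub>n\<close> and every sequence of neighbourhoods \<open>V\<^sub>k\<close> of \<open>1\<close> there is a point \<open>p\<close> such that
  each \<open>p V\<^sub>k\<close> and each \<open>V\<^sub>k p\<close> meets infinitely many \<open>A\<^sub>n\<close>. As only countably many neighbourhoods are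
  involved, this property passes from \<open>H\<close> and \<open>G/H\<close> to \<open>G\<close> by a diagonal argument, provided that
  conjugation by elements of \<open>H\<close> is equicontinuous at \<open>1\<close>. In a regular group weak clustering
  makes inversion continuous at \<open>1\<close>; applied to \<open>H\<close> this shows that \<open>H\<close> is precompact, which gives
  the equicontinuity, and applied to \<open>G\<close> it shows that \<open>G\<close> is a topological group. Finally, a weakly
  clustering topological group is feebly compact.
\<close>

section \<open>Cluster points of sequences of open sets\<close>

text \<open>Without a cluster point the range of \<open>A\<close> would be locally finite, hence
  finite. Then one set recurs for infinitely many indices, and each of its points is a cluster point
  after all.\<close>

lemma feebly_compact_cluster:
  assumes "feebly_compact X" and A: "\<And>n::nat. openin X (A n)" "\<And>n. A n \<noteq> {}"
  shows "\<exists>p\<in>topspace X. \<forall>U N. openin X U \<longrightarrow> p \<in> U \<longrightarrow> (\<exists>n\<ge>N. U \<inter> A n \<noteq> {})"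
proof (rule ccontr)
  assume neg: "\<not> ?thesis"
  have loc: "\<exists>U. openin X U \<and> p \<in> U \<and> finite {n. U \<inter> A n \<noteq> {}}" if p: "p \<in> topspace X" for p
  proof -
    obtain U N where U: "openin X U" "p \<in> U" "\<forall>n\<ge>N. U \<inter> A n = {}"
      using neg[simplified] p by metis
    then have "{n. U \<inter> A n \<noteq> {}} \<subseteq> {..<N}"
      using not_less by auto
    then have "finite {n. U \<inter> A n \<noteq> {}}"
      using finite_subset by blast
    then show ?thesis
      using U by auto
  qed
  have "locally_finite_in X (range A)"
    unfolding locally_finite_in_def
  proof (intro conjI ballI)
    show "\<Union> (range A) \<subseteq> topspace X"
      using A(1) openin_subset by blast
    fix p assume "p \<in> topspace X"
    then obtain U where U: "openin X U" "p \<in> U" "finite {n. U \<inter> A n \<noteq> {}}"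
      using loc by metis
    have "{B \<in> range A. B \<inter> U \<noteq> {}} \<subseteq> A ` {n. U \<inter> A n \<noteq> {}}"
      by blast
    then show "\<exists>V. openin X V \<and> p \<in> V \<and> finite {B \<in> range A. B \<inter> V \<noteq> {}}"
      using U finite_surj[of "{n. U \<inter> A n \<noteq> {}}" _ A] by auto
  qed
  then have "finite (range A)"
    using assms unfolding feebly_compact_def by blast
  then obtain m where m: "infinite {n. A n = A m}"
    using pigeonhole_infinite[of "UNIV :: nat set" A] by auto
  obtain p where p: "p \<in> A m"
    using A(2) by blast
  then have "p \<in> topspace X"
    using openin_subset[OF A(1)] by blast
  then obtain U where U: "p \<in> U" "finite {n. U \<inter> A n \<noteq> {}}"
    using loc by metis
  have "{n. A n = A m} \<subseteq> {n. U \<inter> A n \<noteq> {}}"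
    using p U(1) by auto
  then show False
    using U(2) m finite_subset by blast
qed

lemma feebly_compactI_cluster:
  assumes "\<And>A :: nat \<Rightarrow> 'a set. \<lbrakk>\<And>n. openin X (A n); \<And>n. A n \<noteq> {}\<rbrakk> \<Longrightarrow>
      \<exists>p\<in>topspace X. \<forall>U N. openin X U \<longrightarrow> p \<in> U \<longrightarrow> (\<exists>n\<ge>N. U \<inter> A n \<noteq> {})"
  shows "feebly_compact X"
  unfolding feebly_compact_def
proof (intro allI impI, rule ccontr)
  fix \<U> assume \<U>: "(\<forall>U\<in>\<U>. openin X U) \<and> locally_finite_in X \<U>" and "infinite \<U>"
  then have "infinite (\<U> - {{}})"
    by simp
  then obtain A :: "nat \<Rightarrow> 'a set" where A: "inj A" "range A \<subseteq> \<U> - {{}}"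
    using infinite_countable_subset by blast
  then have *: "openin X (A n)" "A n \<noteq> {}" for n
    using \<U> by blast+
  obtain p where p: "p \<in> topspace X"
      "\<forall>U N. openin X U \<longrightarrow> p \<in> U \<longrightarrow> (\<exists>n\<ge>N. U \<inter> A n \<noteq> {})"
    using assms[of A] * by auto
  have "\<forall>x\<in>topspace X. \<exists>U. openin X U \<and> x \<in> U \<and> finite {B \<in> \<U>. B \<inter> U \<noteq> {}}"
    using \<U> unfolding locally_finite_in_def by auto
  then obtain U where U: "openin X U" "p \<in> U" "finite {B \<in> \<U>. B \<inter> U \<noteq> {}}"
    using p(1) by auto
  \<comment> \<open>Injectivity of \<open>A\<close> turns finitely many members meeting
    \<open>U\<close> into finitely many indices, so the indices are bounded.\<close>
  have "A ` {n. U \<inter> A n \<noteq> {}} \<subseteq> {B \<in> \<U>. B \<inter> U \<noteq> {}}"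
    using A by blast
  then have "finite {n. U \<inter> A n \<noteq> {}}"
    using U(3) A(1) by (meson finite_imageD finite_subset inj_on_subset subset_UNIV)
  then obtain N where "\<forall>n. U \<inter> A n \<noteq> {} \<longrightarrow> n < N"
    unfolding finite_nat_set_iff_bounded by auto
  moreover have "\<exists>n\<ge>N. U \<inter> A n \<noteq> {}"
    using p(2) U by auto
  ultimately show False
    using not_less by auto
qed

text \<open>Open families and local finiteness both pass from the coarser topology to the finer
  one.\<close>

lemma feebly_compact_coarser:
  assumes "feebly_compact X" "topspace Y = topspace X" "\<And>U. openin Y U \<Longrightarrow> openin X U"
  shows "feebly_compact Y"
proof -
  have "locally_finite_in X \<U>" if "locally_finite_in Y \<U>" for \<U>
    using that assms(2,3) unfolding locally_finite_in_def by fastforce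
  then show ?thesis
    using assms unfolding feebly_compact_def by blast
qed

section \<open>Semiregularization\<close>

abbreviation int_cl :: "'a topology \<Rightarrow> 'a set \<Rightarrow> 'a set" where
  "int_cl X U \<equiv> X interior_of (X closure_of U)"

text \<open>The coarser topology that has the regular open sets \<open>int_cl X U\<close> as a base,
  written as a pointwise neighbourhood condition.\<close>

definition semiregularization :: "'a topology \<Rightarrow> 'a topology" where
  "semiregularization X = topology (\<lambda>W. W \<subseteq> topspace X \<and>
     (\<forall>x\<in>W. \<exists>U. openin X U \<and> x \<in> U \<and> int_cl X U \<subseteq> W))"

lemma openin_semiregularization:
  "openin (semiregularization X) W \<longleftrightarrow> W \<subseteq> topspace X \<and>
     (\<forall>x\<in>W. \<exists>U. openin X U \<and> x \<in> U \<and> int_cl X U \<subseteq> W)"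
proof -
  have "istopology (\<lambda>W. W \<subseteq> topspace X \<and>
     (\<forall>x\<in>W. \<exists>U. openin X U \<and> x \<in> U \<and> int_cl X U \<subseteq> W))"
    unfolding istopology_def
  proof (rule conjI; clarify; rule conjI)
    fix S W
    assume S: "\<forall>x\<in>S. \<exists>U. openin X U \<and> x \<in> U \<and> int_cl X U \<subseteq> S"
      and W: "\<forall>x\<in>W. \<exists>U. openin X U \<and> x \<in> U \<and> int_cl X U \<subseteq> W"
    show "\<forall>x\<in>S \<inter> W. \<exists>U. openin X U \<and> x \<in> U \<and> int_cl X U \<subseteq> S \<inter> W"
    proof
      fix x assume "x \<in> S \<inter> W"
      then have "x \<in> S" "x \<in> W"
        by auto
      then obtain U U' where U: "openin X U" "x \<in> U" "int_cl X U \<subseteq> S"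
        and U': "openin X U'" "x \<in> U'" "int_cl X U' \<subseteq> W"
        using S[rule_format, of x] W[rule_format, of x] by auto
      have "int_cl X (U \<inter> U') \<subseteq> int_cl X U" "int_cl X (U \<inter> U') \<subseteq> int_cl X U'"
        by (simp_all add: closure_of_mono interior_of_mono)
      then have "int_cl X (U \<inter> U') \<subseteq> S \<inter> W"
        using U(3) U'(3) by auto
      then show "\<exists>U. openin X U \<and> x \<in> U \<and> int_cl X U \<subseteq> S \<inter> W"
        using U U' by (intro exI[of _ "U \<inter> U'"]) auto
    qed
  next
    fix \<K>
    assume K: "\<forall>K\<in>\<K>. K \<subseteq> topspace X \<and>
      (\<forall>x\<in>K. \<exists>U. openin X U \<and> x \<in> U \<and> int_cl X U \<subseteq> K)"
    show "\<forall>x\<in>\<Union>\<K>. \<exists>U. openin X U \<and> x \<in> U \<and> int_cl X U \<subseteq> \<Union>\<K>"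
    proof
      fix x assume "x \<in> \<Union>\<K>"
      then obtain K where "K \<in> \<K>" "x \<in> K"
        by auto
      moreover from this obtain U where "openin X U" "x \<in> U" "int_cl X U \<subseteq> K"
        using K by (metis (no_types, lifting))
      ultimately show "\<exists>U. openin X U \<and> x \<in> U \<and> int_cl X U \<subseteq> \<Union>\<K>"
        by auto
    qed
  qed blast+
  then show ?thesis
    by (simp add: semiregularization_def)
qed

lemma topspace_semiregularization [simp]: "topspace (semiregularization X) = topspace X"
proof
  show "topspace (semiregularization X) \<subseteq> topspace X"
    using openin_topspace[of "semiregularization X"] unfolding openin_semiregularization by simp
  have "openin (semiregularization X) (topspace X)"
    unfolding openin_semiregularization
    using interior_of_subset_topspace[of X] openin_topspace[of X] by auto
  then show "topspace X \<subseteq> topspace (semiregularization X)"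
    by (rule openin_subset)
qed

lemma openin_semiregularization_imp:
  assumes "openin (semiregularization X) W"
  shows "openin X W"
proof (subst openin_subopen, clarify)
  fix x assume "x \<in> W"
  then obtain U where "openin X U" "x \<in> U" "int_cl X U \<subseteq> W"
    using assms openin_semiregularization by metis
  then show "\<exists>U. openin X U \<and> x \<in> U \<and> U \<subseteq> W"
    by (meson closure_of_subset interior_of_maximal openin_subset order_trans)
qed

lemma openin_semiregularization_interior_closure:
  "openin (semiregularization X) (int_cl X U)"
  unfolding openin_semiregularization
proof (intro conjI ballI)
  show "int_cl X U \<subseteq> topspace X"
    by (rule interior_of_subset_topspace)
  fix x assume "x \<in> int_cl X U"
  moreover have "int_cl X (int_cl X U)
      \<subseteq> int_cl X U"
    by (meson closedin_closure_of closure_of_minimal interior_of_mono interior_of_subset)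
  ultimately show "\<exists>V. openin X V \<and> x \<in> V \<and>
      int_cl X V \<subseteq> int_cl X U"
    using openin_interior_of by blast
qed

lemma subset_interior_closure:
  "openin X U \<Longrightarrow> U \<subseteq> int_cl X U"
  by (simp add: closure_of_subset interior_of_maximal openin_subset)

text \<open>Two open sets meet as soon as their regular open hulls \<open>int_cl\<close> meet. A
  cluster point of the hulls of \<open>A n\<close> in the semiregularization is therefore a cluster
  point of the \<open>A n\<close> themselves.\<close>

lemma feebly_compact_semiregularization:
  assumes "feebly_compact (semiregularization X)"
  shows "feebly_compact X"
proof (rule feebly_compactI_cluster)
  fix A :: "nat \<Rightarrow> 'a set"
  assume A: "\<And>n. openin X (A n)" "\<And>n. A n \<noteq> {}"
  let ?r = "\<lambda>U. int_cl X U"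
  have "openin (semiregularization X) (?r (A n))" "?r (A n) \<noteq> {}" for n
    using openin_semiregularization_interior_closure A subset_interior_closure by blast+
  from feebly_compact_cluster[where A = "\<lambda>n. ?r (A n)", OF assms this] obtain p where p: "p \<in> topspace X"
    "\<forall>U N. openin (semiregularization X) U \<longrightarrow> p \<in> U \<longrightarrow> (\<exists>n\<ge>N. U \<inter> ?r (A n) \<noteq> {})"
    by auto
  have "\<exists>n\<ge>N. U \<inter> A n \<noteq> {}" if U: "openin X U" "p \<in> U" for U N
  proof -
    obtain n where n: "n \<ge> N" "?r U \<inter> ?r (A n) \<noteq> {}"
      using p(2)[rule_format, OF openin_semiregularization_interior_closure, of U N]
        subset_interior_closure[OF U(1)] U by auto
    \<comment> \<open>An open set that meets the closure of a set meets the set. This is applied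
      first to reach \<open>U\<close>, then to reach \<open>A n\<close>.\<close>
    have "openin X (?r U \<inter> ?r (A n))"
      by (intro openin_Int openin_interior_of)
    then have "?r U \<inter> ?r (A n) \<inter> U \<noteq> {}"
      using n(2) interior_of_subset[of X "X closure_of U"]
        openin_Int_closure_of_eq_empty[of X "?r U \<inter> ?r (A n)" U] by blast
    moreover have "openin X (U \<inter> ?r (A n))"
      using U(1) by (intro openin_Int openin_interior_of)
    ultimately have "U \<inter> ?r (A n) \<inter> A n \<noteq> {}"
      using interior_of_subset[of X "X closure_of A n"]
        openin_Int_closure_of_eq_empty[of X "U \<inter> ?r (A n)" "A n"] by blast
    then show ?thesis
      using n(1) by blast
  qed
  then show "\<exists>p\<in>topspace X. \<forall>U N. openin X U \<longrightarrow> p \<in> U \<longrightarrow> (\<exists>n\<ge>N. U \<inter> A n \<noteq> {})"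
    using p(1) by blast
qed

lemma regular_space_closure_nbhd:
  assumes "regular_space X" "openin X U" "x \<in> U"
  obtains V where "openin X V" "x \<in> V" "X closure_of V \<subseteq> U"
proof -
  obtain V C where "openin X V" "closedin X C" "x \<in> V" "V \<subseteq> C" "C \<subseteq> U"
    using assms unfolding neighbourhood_base_of_closedin[symmetric] neighbourhood_base_of by metis
  then show thesis
    using that by (meson closure_of_minimal order_trans)
qed

section \<open>Neighbourhoods of the identity\<close>

context paratopological_group
begin

lemma in_carrier: "openin T U \<Longrightarrow> x \<in> U \<Longrightarrow> x \<in> carrier G"
  using openin_subset topspace_eq by blast

lemma mult_nbhds:
  assumes "openin T U" "a \<in> carrier G" "b \<in> carrier G" "a \<otimes> b \<in> U"
  obtains A B where "openin T A" "openin T B" "a \<in> A" "b \<in> B"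
    "\<forall>x\<in>A. \<forall>y\<in>B. x \<otimes> y \<in> U"
proof -
  let ?P = "{z \<in> topspace (prod_topology T T). (case z of (x, y) \<Rightarrow> x \<otimes> y) \<in> U}"
  have P: "openin (prod_topology T T) ?P"
    using continuous_mult assms(1) by (rule openin_continuous_map_preimage)
  have "(a, b) \<in> ?P"
    using assms topspace_eq by auto
  from P[unfolded openin_prod_topology_alt, rule_format, OF this]
  obtain A B where "openin T A" "openin T B" "a \<in> A" "b \<in> B" "A \<times> B \<subseteq> ?P"
    by auto
  moreover have "\<forall>x\<in>A. \<forall>y\<in>B. x \<otimes> y \<in> U"
    using \<open>A \<times> B \<subseteq> ?P\<close> by auto
  ultimately show thesis
    using that by simp
qed

lemma openin_left_translate:
  assumes "openin T U" "g \<in> carrier G"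
  shows "openin T {x \<in> carrier G. g \<otimes> x \<in> U}"
proof (subst openin_subopen, clarify)
  fix x assume x: "x \<in> carrier G" "g \<otimes> x \<in> U"
  obtain A B where "openin T A" "openin T B" "g \<in> A" "x \<in> B"
    "\<forall>x\<in>A. \<forall>y\<in>B. x \<otimes> y \<in> U"
    using mult_nbhds[OF assms x] by metis
  then show "\<exists>V. openin T V \<and> x \<in> V \<and> V \<subseteq> {x \<in> carrier G. g \<otimes> x \<in> U}"
    using in_carrier by (intro exI[of _ B]) auto
qed

lemma openin_right_translate:
  assumes "openin T U" "g \<in> carrier G"
  shows "openin T {x \<in> carrier G. x \<otimes> g \<in> U}"
proof (subst openin_subopen, clarify)
  fix x assume x: "x \<in> carrier G" "x \<otimes> g \<in> U"
  obtain A B where "openin T A" "openin T B" "x \<in> A" "g \<in> B"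
    "\<forall>x\<in>A. \<forall>y\<in>B. x \<otimes> y \<in> U"
    using mult_nbhds[OF assms(1) x(1) assms(2) x(2)] by metis
  then show "\<exists>V. openin T V \<and> x \<in> V \<and> V \<subseteq> {x \<in> carrier G. x \<otimes> g \<in> U}"
    using in_carrier by (intro exI[of _ A]) auto
qed

definition nbhd :: "'a set \<Rightarrow> bool" where
  "nbhd U \<longleftrightarrow> openin T U \<and> \<one> \<in> U"

lemma nbhd_carrier: "nbhd U \<Longrightarrow> x \<in> U \<Longrightarrow> x \<in> carrier G"
  using in_carrier nbhd_def by blast

lemma nbhd_Int: "nbhd U \<Longrightarrow> nbhd V \<Longrightarrow> nbhd (U \<inter> V)"
  by (auto simp: nbhd_def)

lemma nbhd_whole: "nbhd (carrier G)"
  using openin_topspace[of T] topspace_eq by (auto simp: nbhd_def)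

lemma nbhd_square:
  assumes "nbhd U"
  obtains V where "nbhd V" "V \<subseteq> U" "\<forall>x\<in>V. \<forall>y\<in>V. x \<otimes> y \<in> U"
proof -
  obtain A B where "openin T A" "openin T B" "\<one> \<in> A" "\<one> \<in> B"
    "\<forall>x\<in>A. \<forall>y\<in>B. x \<otimes> y \<in> U"
    using mult_nbhds[of U \<one> \<one>] assms by (auto simp: nbhd_def)
  then show thesis
    using that[of "A \<inter> B \<inter> U"] assms by (auto simp: nbhd_def)
qed

lemma nbhd_left:
  assumes "openin T U" "g \<in> U"
  shows "nbhd {x \<in> carrier G. g \<otimes> x \<in> U}"
  using openin_left_translate in_carrier[OF assms] assms by (auto simp: nbhd_def)

lemma nbhd_right:
  assumes "openin T U" "g \<in> U"
  shows "nbhd {x \<in> carrier G. x \<otimes> g \<in> U}"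
  using openin_right_translate in_carrier[OF assms] assms by (auto simp: nbhd_def)

lemma nbhd_conj:
  assumes "nbhd U" "g \<in> carrier G"
  obtains V where "nbhd V" "\<forall>x\<in>V. g \<otimes> x \<otimes> inv g \<in> U"
proof -
  let ?W = "{x \<in> carrier G. x \<otimes> inv g \<in> U}"
  have "openin T ?W" "g \<in> ?W"
    using assms openin_right_translate by (auto simp: nbhd_def)
  from nbhd_left[OF this] show thesis
    by (rule that) auto
qed

lemma inv_mult_cancel [simp]:
  assumes "x \<in> carrier G" "y \<in> carrier G"
  shows "inv x \<otimes> (x \<otimes> y) = y" "x \<otimes> (inv x \<otimes> y) = y"
  using assms by (simp_all flip: m_assoc)


section \<open>Weak clustering\<close>

definition weakly_clustering :: bool where
  "weakly_clustering \<longleftrightarrow> (\<forall>A V. (\<forall>n::nat. openin T (A n) \<and> A n \<noteq> {}) \<longrightarrow> (\<forall>k::nat. nbhd (V k)) \<longrightarrow>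
     (\<exists>p\<in>carrier G. \<forall>k N. (\<exists>n\<ge>N. \<exists>v\<in>V k. p \<otimes> v \<in> A n) \<and> (\<exists>n\<ge>N. \<exists>v\<in>V k. v \<otimes> p \<in> A n)))"

lemma weakly_clusteringD:
  assumes "weakly_clustering" "\<And>n::nat. openin T (A n)" "\<And>n. A n \<noteq> {}" "\<And>k::nat. nbhd (V k)"
  obtains p where "p \<in> carrier G" "\<forall>k N. \<exists>n\<ge>N. \<exists>v\<in>V k. p \<otimes> v \<in> A n"
    "\<forall>k N. \<exists>n\<ge>N. \<exists>v\<in>V k. v \<otimes> p \<in> A n"
proof -
  have "\<exists>p\<in>carrier G. \<forall>k N. (\<exists>n\<ge>N. \<exists>v\<in>V k. p \<otimes> v \<in> A n) \<and> (\<exists>n\<ge>N. \<exists>v\<in>V k. v \<otimes> p \<in> A n)"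
    using assms unfolding weakly_clustering_def by auto
  then show thesis
    using that by metis
qed

text \<open>The translates of each \<open>V k\<close> by a genuine cluster point \<open>p\<close>,
  on either side, are neighbourhoods of \<open>p\<close>.\<close>

lemma feebly_compact_imp_weakly_clustering:
  assumes "feebly_compact T"
  shows "weakly_clustering"
  unfolding weakly_clustering_def
proof (intro allI impI)
  fix A V :: "nat \<Rightarrow> 'a set"
  assume A: "\<forall>n. openin T (A n) \<and> A n \<noteq> {}" and V: "\<forall>k. nbhd (V k)"
  obtain p where p: "p \<in> carrier G" "\<forall>U N. openin T U \<longrightarrow> p \<in> U \<longrightarrow> (\<exists>n\<ge>N. U \<inter> A n \<noteq> {})"
    using feebly_compact_cluster[of T A] assms A topspace_eq by auto
  have "(\<exists>n\<ge>N. \<exists>v\<in>V k. p \<otimes> v \<in> A n) \<and> (\<exists>n\<ge>N. \<exists>v\<in>V k. v \<otimes> p \<in> A n)" for k N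
  proof
    let ?U = "{x \<in> carrier G. inv p \<otimes> x \<in> V k}"
    have "openin T ?U" "p \<in> ?U"
      using V p(1) openin_left_translate[of "V k" "inv p"] by (auto simp: nbhd_def)
    then obtain n x where "n \<ge> N" "x \<in> ?U" "x \<in> A n"
      using p(2) by blast
    then show "\<exists>n\<ge>N. \<exists>v\<in>V k. p \<otimes> v \<in> A n"
      using p(1) by (intro exI[of _ n] conjI bexI[of _ "inv p \<otimes> x"]) auto
  next
    let ?U = "{x \<in> carrier G. x \<otimes> inv p \<in> V k}"
    have "openin T ?U" "p \<in> ?U"
      using V p(1) openin_right_translate[of "V k" "inv p"] by (auto simp: nbhd_def)
    then obtain n x where "n \<ge> N" "x \<in> ?U" "x \<in> A n"
      using p(2) by blast
    then show "\<exists>n\<ge>N. \<exists>v\<in>V k. v \<otimes> p \<in> A n"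
      using p(1) by (intro exI[of _ n] conjI bexI[of _ "x \<otimes> inv p"]) (auto simp: m_assoc)
  qed
  then show "\<exists>p\<in>carrier G. \<forall>k N. (\<exists>n\<ge>N. \<exists>v\<in>V k. p \<otimes> v \<in> A n) \<and> (\<exists>n\<ge>N. \<exists>v\<in>V k. v \<otimes> p \<in> A n)"
    using p(1) by blast
qed

text \<open>
  Otherwise there are neighbourhoods \<open>V\<^sub>n\<close> with \<open>V\<^bsub>n+1\<^esub> V\<^bsub>n+1\<^esub> \<subseteq> V\<^sub>n\<close> and \<open>x\<^sub>n \<in> V\<^sub>n\<close> whose inverses avoid
  the closure of \<open>U'\<close>. The contradiction comes from a cluster point of the sets \<open>y\<^sub>n D\<^sub>n\<close>, where
  \<open>y\<^sub>n = x\<^sub>0 \<cdots> x\<^bsub>n-1\<^esub>\<close>. Every \<open>y\<^sub>n D\<^sub>n\<close> with \<open>n > m\<close> is contained in \<open>y\<^sub>m x\<^sub>m V\<^sub>m\<close>, so returning close to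
  \<open>y\<^sub>m D\<^sub>m\<close> puts an approximation of \<open>x\<^sub>m\<^sup>-\<^sup>1\<close> into \<open>U'\<close>. The right multiple \<open>p V\<^sub>0\<close> is used at stage \<open>m\<close>
  and the left multiple \<open>V\<^bsub>m+1\<^esub> p\<close> at stage \<open>n\<close>, because \<open>V\<^bsub>m+1\<^esub>\<close> can be chosen small
  after conjugation by \<open>y\<^sub>m\<close>.
\<close>

lemma nbhd_inv_closed:
  assumes "weakly_clustering" "regular_space T" "nbhd U"
  obtains V where "nbhd V" "\<forall>x\<in>V. inv x \<in> U"
proof (rule ccontr)
  assume "\<not> thesis"
  then have no_inv: "\<exists>x\<in>V. inv x \<notin> U" if "nbhd V" for V
    using that \<open>\<And>V. nbhd V \<Longrightarrow> \<forall>x\<in>V. inv x \<in> U \<Longrightarrow> thesis\<close> by blast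
  obtain U' where U': "openin T U'" "\<one> \<in> U'" "T closure_of U' \<subseteq> U"
    using regular_space_closure_nbhd[of T U \<one>] assms(2,3) unfolding nbhd_def by metis
  have separate: "\<exists>x\<in>V. \<exists>D\<subseteq>V. nbhd D \<and> (\<forall>a\<in>D. \<forall>b\<in>D. inv x \<otimes> a \<otimes> b \<notin> U')"
    if V: "nbhd V" for V
  proof -
    obtain x where x: "x \<in> V" "inv x \<notin> U"
      using no_inv[OF V] by blast
    then have x_carrier: "x \<in> carrier G"
      using V nbhd_carrier by blast
    have "inv x \<notin> T closure_of U'"
      using x U' by auto
    then obtain W where W: "openin T W" "inv x \<in> W" "W \<inter> U' = {}"
      using x_carrier topspace_eq unfolding in_closure_of by auto
    obtain D where D: "nbhd D" "\<forall>a\<in>D. \<forall>b\<in>D. a \<otimes> b \<in> {a \<in> carrier G. inv x \<otimes> a \<in> W}"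
      using nbhd_square[OF nbhd_left[OF W(1,2)]] by metis
    have "inv x \<otimes> a \<otimes> b \<notin> U'" if "a \<in> D" "b \<in> D" for a b
      using that x_carrier W(3) D(2) nbhd_carrier[OF D(1)] by (auto simp: m_assoc)
    then show ?thesis
      using D(1) V x(1) by (intro bexI[of _ x] exI[of _ "D \<inter> V"]) (auto simp: nbhd_Int)
  qed
  \<comment> \<open>A state holds the current neighbourhood \<open>V\<close>, the product
    \<open>y\<close> of the earlier elements, the next bad element \<open>x\<close>, and a
    \<open>D\<close> witnessing that \<open>x\<close> is bad. The relation \<open>Q\<close> makes
    the next neighbourhood small enough to fall into \<open>D\<close> after conjugation by
    \<open>y\<close>.\<close>
  define P where "P = (\<lambda>(V, y, x, D). nbhd V \<and> y \<in> carrier G \<and> x \<in> V \<and> D \<subseteq> V \<and> nbhd D \<and>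
    (\<forall>a\<in>D. \<forall>b\<in>D. inv x \<otimes> a \<otimes> b \<notin> U'))"
  define Q where "Q = (\<lambda>(V, y, x, D) (V', y', x' :: 'a, D' :: 'a set). V' \<subseteq> V \<and>
    (\<forall>a\<in>V'. \<forall>b\<in>V'. a \<otimes> b \<in> V) \<and> (\<forall>v\<in>V'. inv y \<otimes> v \<otimes> y \<in> D) \<and> y' = y \<otimes> x)"
  obtain V\<^sub>0 where V\<^sub>0: "nbhd V\<^sub>0" "\<forall>a\<in>V\<^sub>0. \<forall>b\<in>V\<^sub>0. a \<otimes> b \<in> U'"
    using nbhd_square[of U'] U' unfolding nbhd_def by metis
  have "\<exists>f. \<forall>n. (P (f n) \<and> (n = 0 \<longrightarrow> fst (f n) = V\<^sub>0)) \<and> Q (f n) (f (Suc n))"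
  proof (rule dependent_nat_choice)
    obtain x D where "x \<in> V\<^sub>0" "D \<subseteq> V\<^sub>0" "nbhd D" "\<forall>a\<in>D. \<forall>b\<in>D. inv x \<otimes> a \<otimes> b \<notin> U'"
      using separate[OF V\<^sub>0(1)] by metis
    then show "\<exists>s. P s \<and> ((0::nat) = 0 \<longrightarrow> fst s = V\<^sub>0)"
      using V\<^sub>0 by (intro exI[of _ "(V\<^sub>0, \<one>, x, D)"]) (auto simp: P_def)
  next
    fix s :: "'a set \<times> 'a \<times> 'a \<times> 'a set" and n :: nat
    assume s: "P s \<and> (n = 0 \<longrightarrow> fst s = V\<^sub>0)"
    obtain V y x D where s_eq: "s = (V, y, x, D)"
      by (metis prod_cases4)
    have V: "nbhd V" "y \<in> carrier G" "x \<in> V" "nbhd D"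
      using s by (auto simp: P_def s_eq)
    obtain V1 where V1: "nbhd V1" "V1 \<subseteq> V" "\<forall>a\<in>V1. \<forall>b\<in>V1. a \<otimes> b \<in> V"
      using nbhd_square[OF V(1)] by metis
    obtain V2 where V2: "nbhd V2" "\<forall>v\<in>V2. inv y \<otimes> v \<otimes> y \<in> D"
      using nbhd_conj[OF V(4), of "inv y"] V(2) by auto
    have V': "nbhd (V1 \<inter> V2)"
      using V1 V2 nbhd_Int by auto
    obtain x' D' where "x' \<in> V1 \<inter> V2" "D' \<subseteq> V1 \<inter> V2" "nbhd D'"
        "\<forall>a\<in>D'. \<forall>b\<in>D'. inv x' \<otimes> a \<otimes> b \<notin> U'"
      using separate[OF V'] by metis
    then show "\<exists>t. (P t \<and> (Suc n = 0 \<longrightarrow> fst t = V\<^sub>0)) \<and> Q s t"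
      using V V1 V2 V' nbhd_carrier[OF V(1)]
      by (intro exI[of _ "(V1 \<inter> V2, y \<otimes> x, x', D')"]) (auto simp: P_def Q_def s_eq)
  qed
  then obtain f where f: "\<forall>n. (P (f n) \<and> (n = 0 \<longrightarrow> fst (f n) = V\<^sub>0)) \<and> Q (f n) (f (Suc n))"
    by auto
  define V where "V n = fst (f n)" for n
  define y where "y n = fst (snd (f n))" for n
  define x where "x n = fst (snd (snd (f n)))" for n
  define D where "D n = snd (snd (snd (f n)))" for n
  have f_eq: "f n = (V n, y n, x n, D n)" for n
    by (simp add: V_def y_def x_def D_def)
  have V: "nbhd (V n)" and y: "y n \<in> carrier G" and x: "x n \<in> V n"
    and D: "D n \<subseteq> V n" "nbhd (D n)" "\<forall>a\<in>D n. \<forall>b\<in>D n. inv (x n) \<otimes> a \<otimes> b \<notin> U'"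
    and V_Suc: "V (Suc n) \<subseteq> V n" "\<forall>a\<in>V (Suc n). \<forall>b\<in>V (Suc n). a \<otimes> b \<in> V n"
      "\<forall>v\<in>V (Suc n). inv (y n) \<otimes> v \<otimes> y n \<in> D n"
    and y_Suc: "y (Suc n) = y n \<otimes> x n" for n
    using f[rule_format, of n] unfolding f_eq P_def Q_def by auto
  have V_0: "V 0 = V\<^sub>0"
    using f by (simp add: V_def)
  have V_mono: "V n \<subseteq> V m" if "m \<le> n" for m n
    using lift_Suc_antimono_le[of V] V_Suc(1) that by auto
  have x_carrier: "x n \<in> carrier G" for n
    using nbhd_carrier[OF V x] .
  \<comment> \<open>Two factors are carried along: going down one index merges \<open>a\<close> and
    \<open>b\<close> into one element of \<open>V n\<close>, and \<open>x n\<close> becomes the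
    other factor.\<close>
  have tail: "\<exists>c\<in>V m. \<exists>d\<in>V m. y n \<otimes> (a \<otimes> b) = y m \<otimes> (c \<otimes> d)"
    if "m \<le> n" "a \<in> V n" "b \<in> V n" for m n a b
    using that
  proof (induction n arbitrary: a b rule: dec_induct)
    case base
    then show ?case by auto
  next
    case (step n)
    have "a \<otimes> b \<in> V n"
      using step.prems V_Suc(2) by auto
    moreover have "y (Suc n) \<otimes> (a \<otimes> b) = y n \<otimes> (x n \<otimes> (a \<otimes> b))"
      using nbhd_carrier[OF V] step.prems y x_carrier by (simp add: y_Suc m_assoc)
    ultimately show ?case
      using step.IH[OF x, of "a \<otimes> b"] by metis
  qed
  let ?A = "\<lambda>n. {z \<in> carrier G. inv (y n) \<otimes> z \<in> D n}"
  have A: "openin T (?A n)" "?A n \<noteq> {}" for n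
  proof -
    show "openin T (?A n)"
      using openin_left_translate D(2) y by (auto simp: nbhd_def)
    have "y n \<in> ?A n"
      using D(2) y by (auto simp: nbhd_def)
    then show "?A n \<noteq> {}"
      by blast
  qed
  obtain p where p: "p \<in> carrier G" "\<forall>k N. \<exists>n\<ge>N. \<exists>v\<in>V k. p \<otimes> v \<in> ?A n"
    "\<forall>k N. \<exists>n\<ge>N. \<exists>v\<in>V k. v \<otimes> p \<in> ?A n"
    by (rule weakly_clusteringD[where A = ?A and V = V, OF assms(1) A V])
  obtain m v where v: "v \<in> V 0" "inv (y m) \<otimes> (p \<otimes> v) \<in> D m"
    using p(2) by blast
  obtain n u where u: "n \<ge> Suc m" "u \<in> V (Suc m)" "inv (y n) \<otimes> (u \<otimes> p) \<in> D n"
    using p(3) by blast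
  have uv: "u \<in> carrier G" "v \<in> carrier G"
    using u v nbhd_carrier[OF V] by auto
  \<comment> \<open>The tail is cut at \<open>Suc m\<close>, so that \<open>x m\<close> remains
    visible in \<open>y (Suc m)\<close>.\<close>
  obtain c d where cd: "c \<in> V (Suc m)" "d \<in> V (Suc m)"
    "y n \<otimes> (\<one> \<otimes> (inv (y n) \<otimes> (u \<otimes> p))) = y (Suc m) \<otimes> (c \<otimes> d)"
    using tail[OF u(1), of \<one> "inv (y n) \<otimes> (u \<otimes> p)"] u(3) V[of n] D(1)[of n]
    by (auto simp: nbhd_def)
  define e where "e = c \<otimes> d"
  have e: "e \<in> V\<^sub>0" "e \<in> carrier G"
    using cd V_Suc(2) V_mono[of 0 m] V_0 nbhd_carrier[OF V] unfolding e_def by auto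
  have up: "u \<otimes> p = y m \<otimes> (x m \<otimes> e)"
    using cd(3) uv p(1) y x_carrier e by (simp add: y_Suc m_assoc flip: e_def)
  \<comment> \<open>The two factors after \<open>inv (x m)\<close> both lie in \<open>D m\<close>,
    so the product must avoid \<open>U'\<close>; but it equals \<open>e \<otimes> v\<close>.\<close>
  have "inv (x m) \<otimes> (inv (y m) \<otimes> u \<otimes> y m) \<otimes> (inv (y m) \<otimes> (p \<otimes> v))
      = inv (x m) \<otimes> (inv (y m) \<otimes> ((u \<otimes> p) \<otimes> v))"
    using uv p(1) y x_carrier by (simp add: m_assoc)
  also have "\<dots> = e \<otimes> v"
    using uv p(1) y x_carrier e unfolding up by (simp add: m_assoc)
  also have "\<dots> \<in> U'"
    using e v(1) V_0 V\<^sub>0(2) by auto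
  finally show False
    using D(3) V_Suc(3) u(2) v(2) by blast
qed

text \<open>
  The first cluster point \<open>p\<close> depends only on the sequence \<open>V\<close>. For an arbitrary neighbourhood of \<open>p\<close>
  a second application, to finer neighbourhoods, yields \<open>q = z p\<close> with \<open>z\<close> in the subgroup
  \<open>\<Inter>n. V\<^sub>n\<close>. Since this subgroup almost preserves \<open>B\<^sub>n = V\<^bsub>n+2\<^esub> a\<^sub>n\<close> from the left, \<open>q\<close> may be replaced by \<open>p\<close>.
\<close>

lemma feebly_compactI_weakly_clustering:
  assumes "weakly_clustering"
    and inv: "\<And>U. nbhd U \<Longrightarrow> \<exists>V. nbhd V \<and> (\<forall>x\<in>V. inv x \<in> U)"
  shows "feebly_compact T"
proof (rule feebly_compactI_cluster)
  fix A :: "nat \<Rightarrow> 'a set"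
  assume A: "\<And>n. openin T (A n)" "\<And>n. A n \<noteq> {}"
  obtain a where a: "a n \<in> A n" for n
    using A(2) choice[of "\<lambda>n x. x \<in> A n"] by auto
  have a_carrier: "a n \<in> carrier G" for n
    using in_carrier[OF A(1) a] .
  have "\<exists>V. \<forall>n. nbhd (V n) \<and> (V (Suc n) \<subseteq> V n \<and> (\<forall>x\<in>V (Suc n). \<forall>y\<in>V (Suc n). x \<otimes> y \<in> V n) \<and>
    (\<forall>x\<in>V (Suc n). inv x \<in> V n) \<and> (\<forall>x\<in>V (Suc n). x \<otimes> a n \<in> A n))"
  proof (rule dependent_nat_choice)
    show "\<exists>V. nbhd V"
      using nbhd_whole by blast
    fix V n assume V: "nbhd V"
    obtain V1 where V1: "nbhd V1" "V1 \<subseteq> V" "\<forall>x\<in>V1. \<forall>y\<in>V1. x \<otimes> y \<in> V"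
      using nbhd_square[OF V] by metis
    obtain V2 where V2: "nbhd V2" "\<forall>x\<in>V2. inv x \<in> V"
      using inv[OF V] by auto
    show "\<exists>V'. nbhd V' \<and> (V' \<subseteq> V \<and> (\<forall>x\<in>V'. \<forall>y\<in>V'. x \<otimes> y \<in> V) \<and>
      (\<forall>x\<in>V'. inv x \<in> V) \<and> (\<forall>x\<in>V'. x \<otimes> a n \<in> A n))"
      using V1 V2 nbhd_right[OF A(1) a, of n]
      by (intro exI[of _ "V1 \<inter> V2 \<inter> {x \<in> carrier G. x \<otimes> a n \<in> A n}"] conjI nbhd_Int) auto
  qed
  then obtain V where V: "nbhd (V n)" and V_Suc: "V (Suc n) \<subseteq> V n"
      "\<forall>x\<in>V (Suc n). \<forall>y\<in>V (Suc n). x \<otimes> y \<in> V n"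
      "\<forall>x\<in>V (Suc n). inv x \<in> V n" "\<forall>x\<in>V (Suc n). x \<otimes> a n \<in> A n" for n
    by metis
  have V_mono: "V n \<subseteq> V m" if "m \<le> n" for m n
    using lift_Suc_antimono_le[of V] V_Suc(1) that by auto
  \<comment> \<open>The index is two steps deeper: one step is spent on a left factor from the
    intersection of the \<open>V j\<close>, the other on getting from \<open>V (Suc n)\<close> into
    \<open>A n\<close>.\<close>
  define B where "B n = {z \<in> carrier G. z \<otimes> inv (a n) \<in> V (Suc (Suc n))}" for n
  have B: "openin T (B n)" "B n \<noteq> {}" for n
  proof -
    show "openin T (B n)"
      using openin_right_translate V a_carrier by (auto simp: nbhd_def B_def)
    have "a n \<in> B n"
      using V a_carrier by (auto simp: nbhd_def B_def)
    then show "B n \<noteq> {}"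
      by blast
  qed
  obtain p where p: "p \<in> carrier G" "\<forall>k N. \<exists>n\<ge>N. \<exists>v\<in>V k. p \<otimes> v \<in> B n"
    "\<forall>k N. \<exists>n\<ge>N. \<exists>v\<in>V k. v \<otimes> p \<in> B n"
    by (rule weakly_clusteringD[where A = B and V = V, OF assms(1) B V])
  have "\<exists>n. n \<ge> k \<and> (\<exists>v\<in>V k. v \<otimes> p \<in> B n)" for k
    using p(3) by auto
  then obtain r where r: "r k \<ge> k" "\<exists>v\<in>V k. v \<otimes> p \<in> B (r k)" for k :: nat
    using choice[of "\<lambda>k n. n \<ge> k \<and> (\<exists>v\<in>V k. v \<otimes> p \<in> B n)"] by auto
  \<comment> \<open>The part of \<open>B (r k)\<close> inside \<open>V k\<close> times
    \<open>p\<close>. Any approximate cluster point of these sets is forced close to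
    \<open>p\<close>.\<close>
  define C where "C k = {z \<in> B (r k). z \<otimes> inv p \<in> V k}" for k
  have C: "openin T (C k)" "C k \<noteq> {}" for k
  proof -
    have "C k = B (r k) \<inter> {z \<in> carrier G. z \<otimes> inv p \<in> V k}"
      by (auto simp: C_def B_def)
    then show "openin T (C k)"
      using B(1) openin_right_translate V p(1) by (auto simp: nbhd_def)
    obtain v where v: "v \<in> V k" "v \<otimes> p \<in> B (r k)"
      using r(2) by blast
    then have "v \<otimes> p \<in> C k"
      using p(1) nbhd_carrier[OF V] by (auto simp: C_def m_assoc)
    then show "C k \<noteq> {}"
      by blast
  qed
  have "\<exists>n\<ge>N. U \<inter> A n \<noteq> {}" if U: "openin T U" "p \<in> U" for U N
  proof -
    \<comment> \<open>Intersecting with \<open>?D\<close> makes the multiplier \<open>v\<close>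
      found for \<open>q\<close> satisfy \<open>p \<otimes> v \<in> U\<close> as well.\<close>
    let ?D = "{z \<in> carrier G. p \<otimes> z \<in> U}"
    have VD: "nbhd (V k \<inter> ?D)" for k
      using nbhd_Int[OF V nbhd_left[OF U]] .
    obtain q where q: "q \<in> carrier G" "\<forall>k N. \<exists>n\<ge>N. \<exists>v\<in>V k \<inter> ?D. q \<otimes> v \<in> C n"
      "\<forall>k N. \<exists>n\<ge>N. \<exists>v\<in>V k \<inter> ?D. v \<otimes> q \<in> C n"
      by (rule weakly_clusteringD[where A = C and V = "\<lambda>k. V k \<inter> ?D", OF assms(1) C VD])
    define z where "z = q \<otimes> inv p"
    have z_carrier: "z \<in> carrier G"
      using q(1) p(1) by (simp add: z_def)
    \<comment> \<open>Here \<open>v \<otimes> z\<close> lies in \<open>V n\<close> by the definition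
      of \<open>C n\<close>, and \<open>v\<close> is cancelled using the control of
      inverses.\<close>
    have z: "z \<in> V j" for j
    proof -
      obtain n v where n: "n \<ge> Suc (Suc j)" "v \<in> V (Suc (Suc j))" "v \<otimes> q \<in> C n"
        using q(3) by blast
      have v: "v \<in> carrier G"
        using n(2) nbhd_carrier[OF V] by blast
      have "v \<otimes> z \<in> V (Suc j)"
        using n v q(1) p(1) V_mono[of "Suc j" n] by (auto simp: C_def z_def m_assoc)
      moreover have "inv v \<in> V (Suc j)"
        using V_Suc(3) n(2) by blast
      ultimately have "inv v \<otimes> (v \<otimes> z) \<in> V j"
        using V_Suc(2) by blast
      then show ?thesis
        using v z_carrier by simp
    qed
    obtain n v where n: "n \<ge> N" "v \<in> ?D" "q \<otimes> v \<in> C n"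
      using q(2) by blast
    let ?m = "r n"
    have v: "v \<in> carrier G" "p \<otimes> v \<in> U"
      using n(2) by auto
    have "q \<otimes> v \<otimes> inv (a ?m) \<in> V (Suc (Suc ?m))"
      using n(3) by (auto simp: C_def B_def)
    moreover have "inv z \<in> V (Suc (Suc ?m))"
      using V_Suc(3) z by blast
    ultimately have "inv z \<otimes> (q \<otimes> v \<otimes> inv (a ?m)) \<in> V (Suc ?m)"
      using V_Suc(2) by blast
    then have "inv z \<otimes> (q \<otimes> v \<otimes> inv (a ?m)) \<otimes> a ?m \<in> A ?m"
      using V_Suc(4) by blast
    moreover have "inv z \<otimes> (q \<otimes> v \<otimes> inv (a ?m)) \<otimes> a ?m = p \<otimes> v"
      using v(1) q(1) p(1) a_carrier by (simp add: z_def m_assoc inv_mult_group)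
    ultimately show ?thesis
      using v(2) n(1) r(1)[of n] le_trans[of N n ?m] by (intro exI[of _ ?m]) auto
  qed
  then show "\<exists>p\<in>topspace T. \<forall>U N. openin T U \<longrightarrow> p \<in> U \<longrightarrow> (\<exists>n\<ge>N. U \<inter> A n \<noteq> {})"
    using p(1) topspace_eq by blast
qed

section \<open>Feebly compact subgroups and extensions\<close>

lemma nbhd_INT:
  assumes "finite I" "\<And>i. i \<in> I \<Longrightarrow> nbhd (W i)"
  shows "\<exists>V. nbhd V \<and> (\<forall>i\<in>I. V \<subseteq> W i)"
  using assms
proof induction
  case empty
  then show ?case
    using nbhd_whole by auto
next
  case (insert i I)
  then obtain V where "nbhd V" "\<forall>i\<in>I. V \<subseteq> W i"
    by auto
  then show ?case
    using insert.prems by (intro exI[of _ "V \<inter> W i"]) (auto intro: nbhd_Int)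
qed

lemma subgroup_paratopological:
  assumes "subgroup H G"
  shows "paratopological_group (G\<lparr>carrier := H\<rparr>) (subtopology T H)"
proof -
  have H: "H \<subseteq> carrier G"
    using assms subgroup.subset by auto
  interpret K: group "G\<lparr>carrier := H\<rparr>"
    using assms by (rule subgroup_imp_group)
  have cont: "continuous_map (prod_topology (subtopology T H) (subtopology T H)) (subtopology T H)
      (\<lambda>(x, y). x \<otimes> y)"
  proof -
    have "continuous_map (subtopology (prod_topology T T) (H \<times> H)) T (\<lambda>(x, y). x \<otimes> y)"
      using continuous_mult by (rule continuous_map_from_subtopology)
    then show ?thesis
      using assms by (auto simp: continuous_map_in_subtopology subtopology_Times[symmetric]
          subgroup.m_closed)
  qed
  show ?thesis
    using H cont topspace_eq by unfold_locales auto
qed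

text \<open>Regularity is hereditary and feeble compactness gives weak clustering, so
  \<open>nbhd_inv_closed\<close> applies inside \<open>H\<close>.\<close>

lemma subgroup_nbhd_inv_closed:
  assumes H: "subgroup H G" and "feebly_compact (subtopology T H)" "regular_space T" "nbhd U"
  obtains V where "nbhd V" "\<forall>x\<in>V \<inter> H. inv x \<in> U"
proof -
  interpret K: paratopological_group "G\<lparr>carrier := H\<rparr>" "subtopology T H"
    using H by (rule subgroup_paratopological)
  have "K.nbhd (U \<inter> H)"
    using assms(4) subgroup.one_closed[OF H] unfolding nbhd_def K.nbhd_def
    by (auto simp: openin_subtopology)
  then obtain V' where V': "K.nbhd V'" "\<forall>x\<in>V'. inv\<^bsub>G\<lparr>carrier := H\<rparr>\<^esub> x \<in> U \<inter> H"
    using K.nbhd_inv_closed[OF K.feebly_compact_imp_weakly_clustering[OF assms(2)]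
        regular_space_subtopology[OF assms(3)]] by metis
  obtain V where V: "openin T V" "V' = V \<inter> H"
    using V'(1) unfolding K.nbhd_def openin_subtopology by auto
  have "nbhd V"
    using V V'(1) unfolding K.nbhd_def nbhd_def by auto
  moreover have "\<forall>x\<in>V \<inter> H. inv x \<in> U"
    using V V'(2) m_inv_consistent[OF H] by auto
  ultimately show thesis
    by (rule that)
qed

text \<open>Otherwise there is a sequence in \<open>H\<close> no two terms of which are
  \<open>U\<close>-close. Small open sets around its terms cluster at some \<open>q\<close>, and two
  terms whose sets come near \<open>q\<close> are close to each other, since inversion on
  \<open>H\<close> is controlled.\<close>

lemma subgroup_precompact:
  assumes H: "subgroup H G" and fc: "feebly_compact (subtopology T H)" and "regular_space T"
    and U: "nbhd U"
  obtains F where "finite F" "F \<subseteq> H" "\<forall>h\<in>H. \<exists>f\<in>F. inv f \<otimes> h \<in> U \<and> inv h \<otimes> f \<in> U"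
proof (rule ccontr)
  assume "\<not> thesis"
  then have escape: "\<exists>h\<in>H. \<forall>f\<in>F. \<not> (inv f \<otimes> h \<in> U \<and> inv h \<otimes> f \<in> U)"
    if "finite F" "F \<subseteq> H" for F
    using that \<open>\<And>F. \<lbrakk>finite F; F \<subseteq> H; \<forall>h\<in>H. \<exists>f\<in>F. inv f \<otimes> h \<in> U \<and> inv h \<otimes> f \<in> U\<rbrakk> \<Longrightarrow> thesis\<close>
    by metis
  have sub: "x \<in> carrier G" if "x \<in> H" for x
    using subgroup.mem_carrier[OF H that] .
  have "\<exists>h. \<forall>n::nat. h n \<in> H \<and> (\<forall>m<n. \<not> (inv (h m) \<otimes> h n \<in> U \<and> inv (h n) \<otimes> h m \<in> U))"
  proof (rule dependent_wellorder_choice)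
    fix n :: nat and h
    assume "\<And>k. k < n \<Longrightarrow> h k \<in> H \<and> (\<forall>m<k. \<not> (inv (h m) \<otimes> h k \<in> U \<and> inv (h k) \<otimes> h m \<in> U))"
    then have "h ` {..<n} \<subseteq> H"
      by auto
    from escape[OF _ this]
    show "\<exists>r. r \<in> H \<and> (\<forall>m<n. \<not> (inv (h m) \<otimes> r \<in> U \<and> inv r \<otimes> h m \<in> U))"
      by auto
  qed simp
  then obtain h where h: "h n \<in> H"
      "m < n \<Longrightarrow> \<not> (inv (h m) \<otimes> h n \<in> U \<and> inv (h n) \<otimes> h m \<in> U)" for m n :: nat
    by auto
  obtain W1 where W1: "nbhd W1" "\<forall>x\<in>W1. \<forall>y\<in>W1. x \<otimes> y \<in> U"
    using nbhd_square[OF U] by metis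
  obtain W2 where W2: "nbhd W2" "\<forall>x\<in>W2. \<forall>y\<in>W2. x \<otimes> y \<in> W1"
    using nbhd_square[OF W1(1)] by metis
  obtain W3 where W3: "nbhd W3" "\<forall>x\<in>W3 \<inter> H. inv x \<in> W2"
    using subgroup_nbhd_inv_closed[OF H fc assms(3) W2(1)] by metis
  define Z where "Z = W2 \<inter> W3"
  have Z: "nbhd Z" "Z \<subseteq> W2" "\<forall>x\<in>Z \<inter> H. inv x \<in> W2"
    using W2(1) W3 nbhd_Int by (auto simp: Z_def)
  have around: "openin (subtopology T H) {x \<in> H. inv q \<otimes> x \<in> Z}" "q \<in> {x \<in> H. inv q \<otimes> x \<in> Z}"
    if q: "q \<in> H" for q
  proof -
    have "{x \<in> H. inv q \<otimes> x \<in> Z} = {x \<in> carrier G. inv q \<otimes> x \<in> Z} \<inter> H"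
      using sub by auto
    then show "openin (subtopology T H) {x \<in> H. inv q \<otimes> x \<in> Z}"
      using openin_left_translate[of Z "inv q"] Z(1) sub[OF q]
      by (auto simp: nbhd_def openin_subtopology)
    show "q \<in> {x \<in> H. inv q \<otimes> x \<in> Z}"
      using q sub[OF q] Z(1) by (auto simp: nbhd_def)
  qed
  let ?A = "\<lambda>n. {x \<in> H. inv (h n) \<otimes> x \<in> Z}"
  have A: "openin (subtopology T H) (?A n)" "?A n \<noteq> {}" for n
    using around[OF h(1)[of n]] by auto
  from feebly_compact_cluster[where A = ?A, OF fc A]
  obtain q where q: "q \<in> topspace (subtopology T H)" "\<forall>U N. openin (subtopology T H) U \<longrightarrow> q \<in> U \<longrightarrow>
      (\<exists>n\<ge>N. U \<inter> ?A n \<noteq> {})"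
    by auto
  have qH: "q \<in> H"
    using q(1) by simp
  have near: "\<exists>n\<ge>N. \<exists>x. x \<in> H \<and> inv q \<otimes> x \<in> Z \<and> inv (h n) \<otimes> x \<in> Z" for N
    using q(2)[rule_format, OF around[OF qH], of N] by auto
  have link: "inv x \<otimes> y \<in> H" if "x \<in> H" "y \<in> H" for x y
    using H that by (simp add: subgroup.m_closed subgroup.m_inv_closed)
  \<comment> \<open>The path from \<open>g\<close> to \<open>g'\<close> runs through
    \<open>x\<close>, \<open>q\<close> and \<open>x'\<close>. Its four factors lie in
    \<open>W2\<close>, two of them as inverses of elements of \<open>Z \<inter> H\<close>.\<close>
  have product: "inv g \<otimes> g' \<in> U"
    if "g \<in> H" "g' \<in> H" "x \<in> H" "x' \<in> H" "inv q \<otimes> x \<in> Z" "inv q \<otimes> x' \<in> Z"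
      "inv g \<otimes> x \<in> Z" "inv g' \<otimes> x' \<in> Z" for g g' x x'
  proof -
    have inv_in: "inv (inv s \<otimes> t) \<in> W2" if "s \<in> H" "t \<in> H" "inv s \<otimes> t \<in> Z" for s t
      using Z(3) link that by auto
    have "inv g \<otimes> x \<otimes> inv (inv q \<otimes> x) \<in> W1"
      using W2(2) Z(2) inv_in that qH by auto
    moreover have "inv q \<otimes> x' \<otimes> inv (inv g' \<otimes> x') \<in> W1"
      using W2(2) Z(2) inv_in that qH by auto
    ultimately have "inv g \<otimes> x \<otimes> inv (inv q \<otimes> x) \<otimes> (inv q \<otimes> x' \<otimes> inv (inv g' \<otimes> x')) \<in> U"
      using W1(2) by auto
    then show ?thesis
      using that qH sub by (simp add: m_assoc inv_mult_group)
  qed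
  obtain m x where m: "x \<in> H" "inv q \<otimes> x \<in> Z" "inv (h m) \<otimes> x \<in> Z"
    using near[of 0] by auto
  obtain n x' where n: "n \<ge> Suc m" "x' \<in> H" "inv q \<otimes> x' \<in> Z" "inv (h n) \<otimes> x' \<in> Z"
    using near[of "Suc m"] by auto
  show False
    using h(2)[of m n] product[of "h m" "h n" x x'] product[of "h n" "h m" x' x] h(1) m n by auto
qed

text \<open>By precompactness \<open>inv h\<close> is close to one of finitely many
  \<open>f\<close>. Conjugation by \<open>h\<close> is then conjugation by \<open>inv f\<close>,
  which finitely many neighbourhoods control, with a small factor on each side.\<close>

lemma subgroup_nbhd_conj:
  assumes H: "subgroup H G" and "feebly_compact (subtopology T H)" "regular_space T" and V: "nbhd V"
  obtains W where "nbhd W" "\<forall>h\<in>H. \<forall>w\<in>W. h \<otimes> w \<otimes> inv h \<in> V"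
proof -
  have sub: "x \<in> carrier G" if "x \<in> H" for x
    using subgroup.mem_carrier[OF H that] .
  obtain U1 where U1: "nbhd U1" "\<forall>x\<in>U1. \<forall>y\<in>U1. x \<otimes> y \<in> V"
    using nbhd_square[OF V] by metis
  obtain U where U: "nbhd U" "U \<subseteq> U1" "\<forall>x\<in>U. \<forall>y\<in>U. x \<otimes> y \<in> U1"
    using nbhd_square[OF U1(1)] by metis
  obtain F where F: "finite F" "F \<subseteq> H" "\<forall>h\<in>H. \<exists>f\<in>F. inv f \<otimes> h \<in> U \<and> inv h \<otimes> f \<in> U"
    using subgroup_precompact[OF H assms(2,3) U(1)] by metis
  have "\<exists>W. nbhd W \<and> (\<forall>w\<in>W. inv f \<otimes> w \<otimes> f \<in> U)" if "f \<in> F" for f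
    using nbhd_conj[OF U(1), of "inv f"] sub that F(2) by (metis inv_closed inv_inv subsetD)
  then obtain w where w: "nbhd (w f)" "\<forall>x\<in>w f. inv f \<otimes> x \<otimes> f \<in> U" if "f \<in> F" for f
    by metis
  obtain W where W: "nbhd W" "\<forall>f\<in>F. W \<subseteq> w f"
    using nbhd_INT[OF F(1), of w] w(1) by auto
  have "h \<otimes> x \<otimes> inv h \<in> V" if hx: "h \<in> H" "x \<in> W" for h x
  proof -
    have "inv h \<in> H"
      using H hx(1) by (rule subgroup.m_inv_closed)
    then obtain f where f: "f \<in> F" "inv f \<otimes> inv h \<in> U" "inv (inv h) \<otimes> f \<in> U"
      using F(3) by blast
    have carr: "h \<in> carrier G" "f \<in> carrier G" "x \<in> carrier G"
      using hx f(1) F(2) sub nbhd_carrier[OF W(1)] by auto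
    have "inv f \<otimes> x \<otimes> f \<in> U"
      using w(2) W(2) f(1) hx(2) by auto
    then have "(h \<otimes> f) \<otimes> (inv f \<otimes> x \<otimes> f) \<otimes> (inv f \<otimes> inv h) \<in> V"
      using U U1(2) f carr by auto
    then show ?thesis
      using carr by (simp add: m_assoc)
  qed
  then show thesis
    using that W(1) by blast
qed

text \<open>A cluster coset \<open>H #> g\<close> of the images of \<open>A\<close> comes first.
  Then a cluster point \<open>q\<close> in \<open>H\<close> is found for the sets of
  \<open>h\<close> that carry points near \<open>g\<close> into \<open>A\<close>. The point sought
  is \<open>q \<otimes> g\<close>.\<close>

lemma extension_weakly_clustering:
  assumes "H \<lhd> G" and fcH: "feebly_compact (subtopology T H)"
    and fcQ: "feebly_compact (quotient_topology T (\<lambda>x. H #> x))" and reg: "regular_space T"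
  shows "weakly_clustering"
  unfolding weakly_clustering_def
proof (intro allI impI)
  fix A V :: "nat \<Rightarrow> 'a set"
  assume A: "\<forall>n. openin T (A n) \<and> A n \<noteq> {}" and V: "\<forall>k. nbhd (V k)"
  have H: "subgroup H G"
    using assms(1) by (rule normal_imp_subgroup)
  have sub: "x \<in> carrier G" if "x \<in> H" for x
    using subgroup.mem_carrier[OF H that] .
  let ?\<pi> = "\<lambda>x. H #> x"
  have coset: "\<exists>h\<in>H. a = h \<otimes> x" if "x \<in> carrier G" "a \<in> carrier G" "H #> x = H #> a" for x a
    using that rcos_self[OF that(2) H] by (auto simp: r_coset_def)
  have coset': "H #> (h \<otimes> x) = H #> x" if "x \<in> carrier G" "h \<in> H" for x h
    using that H repr_independence[of "h \<otimes> x" H x] by (auto simp: r_coset_def)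
  have open_image: "openin (quotient_topology T ?\<pi>) (?\<pi> ` U)" if U: "openin T U" for U
  proof -
    \<comment> \<open>The saturation of an open set is a union of translates, so the quotient map is
      open.\<close>
    have "{x \<in> topspace T. H #> x \<in> ?\<pi> ` U} = (\<Union>h\<in>H. {x \<in> carrier G. h \<otimes> x \<in> U})"
      (is "?L = ?R")
    proof
      show "?L \<subseteq> ?R"
        using coset in_carrier[OF U] by (fastforce simp: topspace_eq)
      show "?R \<subseteq> ?L"
        using coset'[symmetric] by (auto simp: topspace_eq)
    qed
    moreover have "openin T ?R"
      using openin_left_translate[OF U] sub by auto
    ultimately show ?thesis
      using openin_subset[OF U] by (auto simp: openin_quotient_topology)
  qed
  have "openin (quotient_topology T ?\<pi>) (?\<pi> ` A n)" "?\<pi> ` A n \<noteq> {}" for n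
    using open_image A by auto
  from feebly_compact_cluster[where A = "\<lambda>n. ?\<pi> ` A n", OF fcQ this]
  obtain g where g: "g \<in> carrier G" "\<forall>U N. openin (quotient_topology T ?\<pi>) U \<longrightarrow> H #> g \<in> U \<longrightarrow>
      (\<exists>n\<ge>N. U \<inter> ?\<pi> ` A n \<noteq> {})"
    by (auto simp: topspace_eq)
  have g_cluster: "\<exists>n\<ge>N. \<exists>h\<in>H. \<exists>d\<in>D. h \<otimes> (g \<otimes> d) \<in> A n" if D: "nbhd D" for D N
  proof -
    let ?U = "{x \<in> carrier G. inv g \<otimes> x \<in> D}"
    have "openin T ?U" "g \<in> ?U"
      using openin_left_translate[of D "inv g"] D g(1) by (auto simp: nbhd_def)
    then obtain n where n: "n \<ge> N" "?\<pi> ` ?U \<inter> ?\<pi> ` A n \<noteq> {}"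
      using g(2)[rule_format, OF open_image[of ?U], of N] by blast
    then obtain x a where xa: "x \<in> carrier G" "inv g \<otimes> x \<in> D" "a \<in> A n" "H #> x = H #> a"
      by auto
    then obtain h where h: "h \<in> H" "a = h \<otimes> x"
      using coset A in_carrier by metis
    then have "h \<otimes> (g \<otimes> (inv g \<otimes> x)) \<in> A n"
      using xa g(1) by simp
    then show ?thesis
      using n(1) h(1) xa(2) by blast
  qed
  \<comment> \<open>The point \<open>q\<close> is not yet known, so the conjugates must be
    controlled for all \<open>h\<close> in \<open>H\<close> at once.\<close>
  have "\<exists>D. nbhd D \<and> (\<forall>x\<in>D. \<forall>y\<in>D. x \<otimes> y \<in> V k \<and>
      (\<forall>h\<in>H. h \<otimes> (g \<otimes> (x \<otimes> y) \<otimes> inv g) \<otimes> inv h \<in> V k))" for k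
  proof -
    obtain W1 where W1: "nbhd W1" "\<forall>h\<in>H. \<forall>w\<in>W1. h \<otimes> w \<otimes> inv h \<in> V k"
      using subgroup_nbhd_conj[OF H fcH reg] V by metis
    obtain W2 where W2: "nbhd W2" "\<forall>w\<in>W2. g \<otimes> w \<otimes> inv g \<in> W1"
      using nbhd_conj[OF W1(1) g(1)] by metis
    have "nbhd (W2 \<inter> V k)"
      using W2(1) V nbhd_Int by auto
    then obtain D where "nbhd D" "\<forall>x\<in>D. \<forall>y\<in>D. x \<otimes> y \<in> W2 \<inter> V k"
      using nbhd_square by metis
    then show ?thesis
      using W1(2) W2(2) by auto
  qed
  then obtain D' where D': "nbhd (D' k)" "\<forall>x\<in>D' k. \<forall>y\<in>D' k. x \<otimes> y \<in> V k \<and>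
      (\<forall>h\<in>H. h \<otimes> (g \<otimes> (x \<otimes> y) \<otimes> inv g) \<otimes> inv h \<in> V k)" for k
    by metis
  have "\<exists>D. nbhd D \<and> (\<forall>i\<in>{..k}. D \<subseteq> D' i)" for k
    by (rule nbhd_INT) (auto simp: D'(1))
  \<comment> \<open>Diagonal choice: from index \<open>k\<close> on, every \<open>D m\<close> is
    contained in \<open>D' k\<close>.\<close>
  then obtain D where D: "nbhd (D k)" "\<forall>i\<le>k. D k \<subseteq> D' i" for k
    by (metis atMost_iff)
  have "\<forall>k. \<exists>n. n \<ge> k \<and> (\<exists>h\<in>H. \<exists>d\<in>D k. h \<otimes> (g \<otimes> d) \<in> A n)"
    using g_cluster[OF D(1)] by auto
  from choice[OF this]
  obtain r where r: "r k \<ge> k" "\<exists>h\<in>H. \<exists>d\<in>D k. h \<otimes> (g \<otimes> d) \<in> A (r k)" for k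
    by auto
  define E where "E k = {h \<in> H. \<exists>d\<in>D k. h \<otimes> (g \<otimes> d) \<in> A (r k)}" for k
  have E: "openin (subtopology T H) (E k)" "E k \<noteq> {}" for k
  proof -
    have "E k = (\<Union>d\<in>D k. {x \<in> carrier G. x \<otimes> (g \<otimes> d) \<in> A (r k)}) \<inter> H"
      using sub by (auto simp: E_def)
    moreover have "openin T (\<Union>d\<in>D k. {x \<in> carrier G. x \<otimes> (g \<otimes> d) \<in> A (r k)})"
      using A openin_right_translate g(1) nbhd_carrier[OF D(1)] by auto
    ultimately show "openin (subtopology T H) (E k)"
      unfolding openin_subtopology by blast
    show "E k \<noteq> {}"
      using r(2)[of k] by (auto simp: E_def)
  qed
  from feebly_compact_cluster[where A = E, OF fcH E]
  obtain q where q: "q \<in> H" "\<forall>U N. openin (subtopology T H) U \<longrightarrow> q \<in> U \<longrightarrow> (\<exists>n\<ge>N. U \<inter> E n \<noteq> {})"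
    by auto
  define p where "p = q \<otimes> g"
  have carr: "q \<in> carrier G" "p \<in> carrier G"
    using q(1) g(1) sub by (auto simp: p_def)
  have "(\<exists>n\<ge>N. \<exists>v\<in>V k. p \<otimes> v \<in> A n) \<and> (\<exists>n\<ge>N. \<exists>v\<in>V k. v \<otimes> p \<in> A n)" for k N
  proof -
    \<comment> \<open>This is a neighbourhood of \<open>q\<close> because
      \<open>inv p \<otimes> q \<otimes> g\<close> is the identity.\<close>
    let ?U = "{x \<in> carrier G. inv p \<otimes> x \<in> {z \<in> carrier G. z \<otimes> g \<in> D' k}}"
    have "openin T ?U"
      using openin_left_translate[OF openin_right_translate[of "D' k" g], of "inv p"] D'(1) g(1) carr
      by (auto simp: nbhd_def)
    then have "openin (subtopology T H) (?U \<inter> H)"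
      by (auto simp: openin_subtopology)
    moreover have "q \<in> ?U \<inter> H"
      using q(1) carr g(1) D'(1)[of k] by (auto simp: p_def nbhd_def inv_mult_group m_assoc)
    ultimately obtain m x where m: "m \<ge> max N k" "x \<in> ?U" "x \<in> E m"
      using q(2) by blast
    obtain d where d: "d \<in> D m" "x \<otimes> (g \<otimes> d) \<in> A (r m)"
      using m(3) by (auto simp: E_def)
    have d': "d \<in> D' k" "d \<in> carrier G"
      using d(1) D(2)[of m] m(1) nbhd_carrier[OF D(1)] by auto
    define v where "v = inv p \<otimes> x \<otimes> g \<otimes> d"
    have x: "x \<in> carrier G" "inv p \<otimes> x \<otimes> g \<in> D' k"
      using m(2) by auto
    have v: "v \<in> carrier G" "v \<in> V k" "q \<otimes> (g \<otimes> v \<otimes> inv g) \<otimes> inv q \<in> V k"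
      using x d' D'(2)[of k] q(1) g(1) carr by (auto simp: v_def)
    have "p \<otimes> v = x \<otimes> (g \<otimes> d)"
      using x(1) d' g(1) carr by (simp add: v_def m_assoc)
    \<comment> \<open>The same point of \<open>A (r m)\<close> serves both sides: conjugating
      \<open>v\<close> by \<open>p\<close> moves it to the left of \<open>p\<close>.\<close>
    moreover have "q \<otimes> (g \<otimes> v \<otimes> inv g) \<otimes> inv q \<otimes> p = p \<otimes> v"
      using v(1) g(1) carr by (simp add: p_def m_assoc)
    moreover have "r m \<ge> N"
      using m(1) r(1)[of m] by auto
    ultimately show ?thesis
      using v d(2) by metis
  qed
  then show "\<exists>p\<in>carrier G. \<forall>k N. (\<exists>n\<ge>N. \<exists>v\<in>V k. p \<otimes> v \<in> A n) \<and> (\<exists>n\<ge>N. \<exists>v\<in>V k. v \<otimes> p \<in> A n)"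
    using carr(2) by blast
qed

section \<open>Semiregularization of a paratopological group\<close>

text \<open>By continuity the product of \<open>C\<close> and \<open>D\<close> lies in the closure
  of \<open>U\<close>, and it is open as a union of left translates of \<open>D\<close>. Openness of
  \<open>C\<close> is not assumed, so \<open>C\<close> may be a whole closure.\<close>

lemma closure_mult_subset_int_cl:
  assumes AB: "\<forall>a\<in>A. \<forall>b\<in>B. a \<otimes> b \<in> U" and C: "C \<subseteq> T closure_of A"
    and D: "D \<subseteq> T closure_of B" "openin T D" and "c \<in> C" "d \<in> D"
  shows "c \<otimes> d \<in> int_cl T U"
proof -
  have carr: "x \<in> carrier G" if "x \<in> C \<or> x \<in> D" for x
    using that C D(1) closure_of_subset_topspace[of T] topspace_eq by blast
  let ?M = "\<Union>c\<in>C. {x \<in> carrier G. inv c \<otimes> x \<in> D}"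
  have "openin T ?M"
    using openin_left_translate[OF D(2)] carr by auto
  moreover have "?M \<subseteq> T closure_of U"
  proof
    fix x assume "x \<in> ?M"
    then obtain c where c: "c \<in> C" "x \<in> carrier G" "inv c \<otimes> x \<in> D"
      by auto
    define d where "d = inv c \<otimes> x"
    have d: "d \<in> D" "x = c \<otimes> d"
      using c carr by (auto simp: d_def)
    show "x \<in> T closure_of U"
      unfolding in_closure_of
    proof (intro conjI allI impI)
      show "x \<in> topspace T"
        using c topspace_eq by auto
      fix W assume "x \<in> W \<and> openin T W"
      then obtain P Q where P: "openin T P" "openin T Q" "c \<in> P" "d \<in> Q" "\<forall>x\<in>P. \<forall>y\<in>Q. x \<otimes> y \<in> W"
        using mult_nbhds[of W c d] carr c d by metis
      obtain a where "a \<in> A" "a \<in> P"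
        using c(1) C P unfolding closure_of_def by blast
      moreover obtain b where "b \<in> B" "b \<in> Q"
        using d(1) D(1) P unfolding closure_of_def by blast
      ultimately show "\<exists>y. y \<in> U \<and> y \<in> W"
        using AB P(5) by blast
    qed
  qed
  ultimately have "?M \<subseteq> int_cl T U"
    by (simp add: interior_of_maximal)
  moreover have "c \<otimes> d \<in> ?M"
    using assms(5,6) carr by (intro UN_I[of c]) auto
  ultimately show ?thesis
    by blast
qed

lemma paratopological_group_semiregularization:
  "paratopological_group G (semiregularization T)"
proof unfold_locales
  show "topspace (semiregularization T) = carrier G"
    by (simp add: topspace_eq)
  let ?S = "semiregularization T"
  show "continuous_map (prod_topology ?S ?S) ?S (\<lambda>(x, y). x \<otimes> y)"
    unfolding continuous_map_def
  proof (intro conjI allI impI)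
    show "(\<lambda>(x, y). x \<otimes> y) \<in> topspace (prod_topology ?S ?S) \<rightarrow> topspace ?S"
      by (auto simp: topspace_eq)
    fix W assume W: "openin ?S W"
    let ?P = "{z \<in> topspace (prod_topology ?S ?S). (case z of (x, y) \<Rightarrow> x \<otimes> y) \<in> W}"
    show "openin (prod_topology ?S ?S) ?P"
      unfolding openin_prod_topology_alt
    proof (intro allI impI)
      fix x y assume "(x, y) \<in> ?P"
      then have xy: "x \<in> carrier G" "y \<in> carrier G" "x \<otimes> y \<in> W"
        by (auto simp: topspace_eq)
      obtain U where U: "openin T U" "x \<otimes> y \<in> U" "int_cl T U \<subseteq> W"
        using W xy(3) unfolding openin_semiregularization by metis
      obtain A B where AB: "openin T A" "openin T B" "x \<in> A" "y \<in> B" "\<forall>a\<in>A. \<forall>b\<in>B. a \<otimes> b \<in> U"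
        using mult_nbhds[OF U(1) xy(1,2) U(2)] by metis
      have "a \<otimes> b \<in> W" if "a \<in> int_cl T A" "b \<in> int_cl T B" for a b
        using closure_mult_subset_int_cl[OF AB(5) interior_of_subset interior_of_subset
            openin_interior_of that] U(3) by auto
      moreover have "int_cl T A \<subseteq> carrier G" "int_cl T B \<subseteq> carrier G"
        using interior_of_subset_topspace[of T] topspace_eq by auto
      ultimately have "int_cl T A \<times> int_cl T B \<subseteq> ?P"
        by (auto simp: topspace_eq)
      moreover have "x \<in> int_cl T A" "y \<in> int_cl T B"
        using AB subset_interior_closure by blast+
      ultimately show "\<exists>U V. openin ?S U \<and> openin ?S V \<and> x \<in> U \<and> y \<in> V \<and> U \<times> V \<subseteq> ?P"
        by (intro exI[of _ "int_cl T A"] exI[of _ "int_cl T B"] conjI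
            openin_semiregularization_interior_closure)
    qed
  qed
qed

text \<open>If \<open>A\<close> times \<open>B\<close> lies in \<open>U\<close> and \<open>B\<close>
  contains the identity, then the closure of \<open>A\<close> already lies in
  \<open>int_cl T U\<close>. This closure is the closed neighbourhood required.\<close>

lemma regular_space_semiregularization: "regular_space (semiregularization T)"
  unfolding neighbourhood_base_of_closedin[symmetric] neighbourhood_base_of
proof (intro allI impI)
  let ?S = "semiregularization T"
  fix W x assume "openin ?S W \<and> x \<in> W"
  then obtain U where U: "openin T U" "x \<in> U" "int_cl T U \<subseteq> W"
    unfolding openin_semiregularization by metis
  have x: "x \<in> carrier G"
    using in_carrier[OF U(1,2)] .
  obtain A B where AB: "openin T A" "openin T B" "x \<in> A" "\<one> \<in> B" "\<forall>a\<in>A. \<forall>b\<in>B. a \<otimes> b \<in> U"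
    using mult_nbhds[OF U(1) x one_closed] U(2) x by auto
  have "c \<in> int_cl T U" if c: "c \<in> T closure_of A" for c
  proof -
    have "c \<in> carrier G"
      using c closure_of_subset_topspace[of T A] topspace_eq by auto
    then show ?thesis
      using closure_mult_subset_int_cl[OF AB(5) order_refl closure_of_subset[OF openin_subset[OF AB(2)]]
          AB(2) c AB(4)] by simp
  qed
  then have "T closure_of A \<subseteq> W"
    using U(3) by auto
  \<comment> \<open>The complement of the closure of an open set is regular open, so the closure is
    closed in the coarser topology too.\<close>
  moreover have "closedin ?S (T closure_of A)"
  proof -
    let ?C = "topspace T - T closure_of A"
    have C: "openin T ?C"
      by auto
    have "A \<inter> T closure_of ?C = {}"
      using closure_of_subset[OF openin_subset[OF AB(1)]]
      by (subst openin_Int_closure_of_eq_empty[OF AB(1)]) auto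
    then have "int_cl T ?C \<inter> A = {}"
      using interior_of_subset[of T "T closure_of ?C"] by auto
    then have "int_cl T ?C \<inter> T closure_of A = {}"
      by (subst openin_Int_closure_of_eq_empty[OF openin_interior_of])
    then have "int_cl T ?C \<subseteq> ?C"
      using interior_of_subset_topspace[of T "T closure_of ?C"] by auto
    then have "openin ?S ?C"
      using C unfolding openin_semiregularization by auto
    then show ?thesis
      using closure_of_subset_topspace[of T A] by (simp add: closedin_def)
  qed
  ultimately show "\<exists>U V. openin ?S U \<and> closedin ?S V \<and> x \<in> U \<and> U \<subseteq> V \<and> V \<subseteq> W"
    using AB(1,3) subset_interior_closure[OF AB(1)] interior_of_subset[of T "T closure_of A"]
      openin_semiregularization_interior_closure[of T A] by auto
qed

end

theorem theorem4p8:
  fixes G :: "('a, 'b) monoid_scheme" (structure)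
    and T :: "'a topology" and H :: "'a set"
  assumes "paratopological_group G T"
    and "H \<lhd> G"
    and "feebly_compact (subtopology T H)"
    and "feebly_compact (quotient_topology T (\<lambda>x. H #> x))"
  shows "feebly_compact T"
proof -
  let ?S = "semiregularization T"
  interpret T: paratopological_group G T
    by fact
  interpret S: paratopological_group G ?S
    by (rule T.paratopological_group_semiregularization)
  have reg: "regular_space ?S"
    by (rule T.regular_space_semiregularization)
  \<comment> \<open>The subspace and quotient topologies obtained from \<open>?S\<close> are only
    compared with those from \<open>T\<close>: they are coarser, which suffices.\<close>
  have "feebly_compact (subtopology ?S H)"
    using assms(3) by (rule feebly_compact_coarser)
      (auto simp: openin_subtopology dest: openin_semiregularization_imp)
  moreover have "feebly_compact (quotient_topology ?S (\<lambda>x. H #> x))"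
    using assms(4) by (rule feebly_compact_coarser)
      (auto simp: openin_quotient_topology dest: openin_semiregularization_imp)
  ultimately have S: "S.weakly_clustering"
    using S.extension_weakly_clustering assms(2) reg by blast
  \<comment> \<open>Weak clustering is used twice: directly, and with regularity to control
    inversion.\<close>
  have "feebly_compact ?S"
    using S by (rule S.feebly_compactI_weakly_clustering) (metis S S.nbhd_inv_closed reg)
  then show ?thesis
    by (rule feebly_compact_semiregularization)
qed

end
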